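(* Let $D$ be an infinite, connected, distance-transitive, weakly descendant-homogeneous digraph of finite out-valency $m>0$ with no directed cycles, and let $\Gamma=\Gamma(\alpha)$ be its descendant subdigraph. Then the following are equivalent: (a) $D$ has property $Z$; (b) the reachability relation on the edges of $D$ is not universal; (c) $\Gamma$ does not satisfy P3, i.e. there is an integer $i\ge 1$ with $|\Gamma^i(\alpha)|\ge|\Gamma^{i+1}(\alpha)|$.
   Context: A digraph $D$ has vertex set and edge set $E(D)\subseteq D\times D$, no loops; subdigraphs are induced. An $s$-arc ($s\ge0$) from $u$ to $v$ is a sequence $u_0\dots u_s$ with $u_0=u$, $u_s=v$, $(u_i,u_{i+1})\in E(D)$, and $u_{i-1}\neq u_{i+1}$ for $0<i<s$. $D^s(u)$ is the set of vertices reachable from $u$ by an $s$-arc, $\mathrm{desc}(u)=\bigcup_{s\ge0}D^s(u)$, $\mathrm{desc}(X)=\bigcup_{x\in X}\mathrm{desc}(x)$. Distance-transitive: for each $s\ge0$, $\mathrm{Aut}(D)$ is transitive on pairs $(u,v)$ with an $s$-arc but no shorter arc from $u$ to $v$. Weakly descendant-homogeneous: $D$ is vertex transitive and for finite vertex sets $X,Y$ and any isomorphism $f$ between the induced subdigraphs on $\mathrm{desc}(X)$ and $\mathrm{desc}(Y)$ there is an automorphism of $D$ agreeing with $f$ on $X$. A directed cycle is $u_0,\dots,u_n=u_0$ ($n\ge1$) with consecutive edges. The descendant subdigraph $\Gamma=\Gamma(\alpha)$ is the induced subdigraph on $\mathrm{desc}(\alpha)$ for a vertex $\alpha$ (independent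 of $\alpha$ up to isomorphism by vertex transitivity), and $\Gamma^i(\alpha)=D^i(\alpha)$. Property P3 for $\Gamma$: $|\Gamma^i(\alpha)|<|\Gamma^{i+1}(\alpha)|$ for every integer $i\ge1$. Property $Z$: there is a surjection $f$ from the vertices onto $\mathbb{Z}$ with $f(v)=f(u)+1$ for each edge $(u,v)$. An alternating walk is a sequence $x_0x_1\dots x_n$ of vertices such that either $(x_{2i-1},x_{2i})$ and $(x_{2i+1},x_{2i})$ are edges for all relevant $i$, or $(x_{2i},x_{2i-1})$ and $(x_{2i},x_{2i+1})$ are edges for all relevant $i$. For edges $e,e'$, $e$ reaches $e'$ if there is an alternating walk $x_0\dots x_n$ with $e=(x_0,x_1)$ and $e'=(x_{n-1},x_n)$ or $e'=(x_n,x_{n-1})$; this reachability relation is an equivalence relation on $E(D)$, and it is universal if it has a single class. *)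

theory Defs
  imports "Graph_Theory.Digraph_Component"
begin

definition induced_subdigraph :: "'a pair_pre_digraph \<Rightarrow> 'a set \<Rightarrow> 'a pair_pre_digraph" where
  "induced_subdigraph D X =
     \<lparr>pverts = X, parcs = {(u, v). (u, v) \<in> parcs D \<and> u \<in> X \<and> v \<in> X}\<rparr>"

definition is_isomorphism ::
    "'a pair_pre_digraph \<Rightarrow> 'b pair_pre_digraph \<Rightarrow> ('a \<Rightarrow> 'b) \<Rightarrow> bool" where
  "is_isomorphism D D' f \<longleftrightarrow>
     bij_betw f (pverts D) (pverts D') \<and>
     (\<forall>u\<in>pverts D. \<forall>v\<in>pverts D. (u, v) \<in> parcs D \<longleftrightarrow> (f u, f v) \<in> parcs D')"

abbreviation is_automorphism :: "'a pair_pre_digraph \<Rightarrow> ('a \<Rightarrow> 'a) \<Rightarrow> bool" where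
  "is_automorphism D \<equiv> is_isomorphism D D"

text \<open>An \<open>s\<close>-arc is given by its vertices \<open>p 0, \<dots>, p s\<close>; values of \<open>p\<close> beyond \<open>s\<close> are irrelevant.
  The same convention is used for directed cycles and alternating walks.\<close>

definition is_s_arc :: "'a pair_pre_digraph \<Rightarrow> nat \<Rightarrow> (nat \<Rightarrow> 'a) \<Rightarrow> 'a \<Rightarrow> 'a \<Rightarrow> bool" where
  "is_s_arc D s p u v \<longleftrightarrow>
     p 0 = u \<and> p s = v \<and> (\<forall>i\<le>s. p i \<in> pverts D) \<and>
     (\<forall>i<s. (p i, p (i + 1)) \<in> parcs D) \<and>
     (\<forall>i. 0 < i \<and> i < s \<longrightarrow> p (i - 1) \<noteq> p (i + 1))"

text \<open>\<open>arc_sphere D s u\<close> is the set $D^s(u)$; it contains the endpoints of all \<open>s\<close>-arcs from \<open>u\<close>,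
  including those which can also be reached by a shorter arc.\<close>

definition arc_sphere :: "'a pair_pre_digraph \<Rightarrow> nat \<Rightarrow> 'a \<Rightarrow> 'a set" where
  "arc_sphere D s u = {v. \<exists>p. is_s_arc D s p u v}"

definition desc :: "'a pair_pre_digraph \<Rightarrow> 'a \<Rightarrow> 'a set" where
  "desc D u = (\<Union>s. arc_sphere D s u)"

definition desc_set :: "'a pair_pre_digraph \<Rightarrow> 'a set \<Rightarrow> 'a set" where
  "desc_set D X = (\<Union>x\<in>X. desc D x)"

definition vertex_transitive :: "'a pair_pre_digraph \<Rightarrow> bool" where
  "vertex_transitive D \<longleftrightarrow>
     (\<forall>u\<in>pverts D. \<forall>v\<in>pverts D. \<exists>g. is_automorphism D g \<and> g u = v)"

definition at_distance :: "'a pair_pre_digraph \<Rightarrow> nat \<Rightarrow> 'a \<Rightarrow> 'a \<Rightarrow> bool" where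
  "at_distance D s u v \<longleftrightarrow> v \<in> arc_sphere D s u \<and> (\<forall>t<s. v \<notin> arc_sphere D t u)"

definition distance_transitive :: "'a pair_pre_digraph \<Rightarrow> bool" where
  "distance_transitive D \<longleftrightarrow>
     (\<forall>s u v u' v'. at_distance D s u v \<and> at_distance D s u' v' \<longrightarrow>
        (\<exists>g. is_automorphism D g \<and> g u = u' \<and> g v = v'))"

definition weakly_descendant_homogeneous :: "'a pair_pre_digraph \<Rightarrow> bool" where
  "weakly_descendant_homogeneous D \<longleftrightarrow>
     vertex_transitive D \<and>
     (\<forall>X Y f. finite X \<and> X \<subseteq> pverts D \<and> finite Y \<and> Y \<subseteq> pverts D \<and>
        is_isomorphism (induced_subdigraph D (desc_set D X))
                       (induced_subdigraph D (desc_set D Y)) f \<longrightarrow>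
        (\<exists>g. is_automorphism D g \<and> (\<forall>x\<in>X. g x = f x)))"

definition has_directed_cycle :: "'a pair_pre_digraph \<Rightarrow> bool" where
  "has_directed_cycle D \<longleftrightarrow>
     (\<exists>(n::nat) p. n \<ge> 1 \<and> p n = p 0 \<and> (\<forall>i<n. (p i, p (i + 1)) \<in> parcs D))"

definition descendant_subdigraph :: "'a pair_pre_digraph \<Rightarrow> 'a \<Rightarrow> 'a pair_pre_digraph" where
  "descendant_subdigraph D \<alpha> = induced_subdigraph D (desc D \<alpha>)"

definition P3 :: "'a pair_pre_digraph \<Rightarrow> 'a \<Rightarrow> bool" where
  "P3 \<Gamma> \<alpha> \<longleftrightarrow> (\<forall>i\<ge>1. card (arc_sphere \<Gamma> i \<alpha>) < card (arc_sphere \<Gamma> (i + 1) \<alpha>))"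

definition property_Z :: "'a pair_pre_digraph \<Rightarrow> bool" where
  "property_Z D \<longleftrightarrow>
     (\<exists>f :: 'a \<Rightarrow> int. f ` pverts D = UNIV \<and> (\<forall>(u, v)\<in>parcs D. f v = f u + 1))"

definition alternating_walk :: "'a pair_pre_digraph \<Rightarrow> nat \<Rightarrow> (nat \<Rightarrow> 'a) \<Rightarrow> bool" where
  "alternating_walk D n x \<longleftrightarrow>
     (\<forall>i\<le>n. x i \<in> pverts D) \<and>
     ((\<forall>i. (1 \<le> 2 * i \<and> 2 * i \<le> n \<longrightarrow> (x (2 * i - 1), x (2 * i)) \<in> parcs D) \<and>
           (2 * i + 1 \<le> n \<longrightarrow> (x (2 * i + 1), x (2 * i)) \<in> parcs D)) \<or>
      (\<forall>i. (1 \<le> 2 * i \<and> 2 * i \<le> n \<longrightarrow> (x (2 * i), x (2 * i - 1)) \<in> parcs D) \<and>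
           (2 * i + 1 \<le> n \<longrightarrow> (x (2 * i), x (2 * i + 1)) \<in> parcs D)))"

definition reachability :: "'a pair_pre_digraph \<Rightarrow> (('a \<times> 'a) \<times> ('a \<times> 'a)) set" where
  "reachability D =
     {(e, e'). e \<in> parcs D \<and> e' \<in> parcs D \<and>
        (\<exists>n x. n \<ge> 1 \<and> alternating_walk D n x \<and> e = (x 0, x 1) \<and>
               (e' = (x (n - 1), x n) \<or> e' = (x n, x (n - 1))))}"

definition reachability_universal :: "'a pair_pre_digraph \<Rightarrow> bool" where
  "reachability_universal D \<longleftrightarrow> (\<exists>C. parcs D // reachability D = {C})"

text \<open>$\Gamma^i(\alpha) = D^i(\alpha)$ for $\Gamma = \Gamma(\alpha)$, so it does not matter in which of
  the two digraphs the cardinalities in \<open>P3\<close> are computed.\<close>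

lemma arc_sphere_descendant_subdigraph:
  "arc_sphere (descendant_subdigraph D \<alpha>) s \<alpha> = arc_sphere D s \<alpha>"
proof -
  have "is_s_arc (descendant_subdigraph D \<alpha>) s p \<alpha> v" if p: "is_s_arc D s p \<alpha> v" for p v
  proof -
    have "p i \<in> desc D \<alpha>" if "i \<le> s" for i
    proof -
      have "is_s_arc D i p \<alpha> (p i)"
        using p that by (auto simp: is_s_arc_def)
      then show ?thesis by (auto simp: desc_def arc_sphere_def)
    qed
    then show ?thesis
      using p by (auto simp: is_s_arc_def descendant_subdigraph_def induced_subdigraph_def)
  qed
  moreover have "is_s_arc D s p \<alpha> v" if "is_s_arc (descendant_subdigraph D \<alpha>) s p \<alpha> v" for p v
  proof -
    have "desc D \<alpha> \<subseteq> pverts D"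
      by (auto simp: desc_def arc_sphere_def is_s_arc_def)
    then show ?thesis
      using that by (auto simp: is_s_arc_def descendant_subdigraph_def induced_subdigraph_def)
  qed
  ultimately show ?thesis
    unfolding arc_sphere_def by blast
qed

end

theory Submission
  imports Defs
begin

text \<open>Acyclicity and distance transitivity make the spheres around a vertex pairwise disjoint, so
  the in-degree of a vertex within a descendant set depends only on its depth. Call it \<open>indeg n\<close>
  for the arcs from depth \<open>n\<close> to depth \<open>n + 1\<close>; it is non-decreasing in \<open>n\<close>, and counting these arcs
  shows that the spheres grow at \<open>n\<close> iff \<open>indeg n < m\<close>.

  If \<open>indeg n \<ge> m\<close> for some \<open>n\<close>, sphere sizes are eventually constant, so the \<open>k\<close>-sphere of \<open>x\<close> is
  the \<open>(k + 1)\<close>-sphere of \<open>u\<close> for each arc \<open>(u, x)\<close> and all large \<open>k\<close>. Comparing spheres at large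
  depths thus assigns a level to every vertex, which is property \<open>Z\<close>.

  Otherwise \<open>indeg\<close> is constant from some \<open>N\<close> on, and a vertex \<open>N + 1\<close> steps below \<open>u\<close>
  that is not \<open>N\<close> steps below an out-neighbour \<open>x\<close> of \<open>u\<close> has no descendant in common with \<open>x\<close>.
  By homogeneity, disjoint descendant sets can be moved independently of each other. Repeatedly
  replacing a vertex by a sibling in general position, one finds two arcs in one reachability class
  whose heads \<open>x\<close>, \<open>y\<close> have disjoint descendant sets. An automorphism fixing \<open>x\<close> and
  moving \<open>y\<close> to one of its out-neighbours shows that the arcs into and out of \<open>y\<close> are in the
  same class, whence the relation is universal.\<close>

section \<open>Spheres, descendants and automorphisms\<close>

context pair_wf_digraph
begin

abbreviation V where "V \<equiv> pverts G"
abbreviation E where "E \<equiv> parcs G"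
abbreviation aut where "aut \<equiv> is_automorphism G"

definition sphere :: "nat \<Rightarrow> 'a \<Rightarrow> 'a set" where
  "sphere n u = (E ^^ n) `` {u}"

definition parents :: "nat \<Rightarrow> 'a \<Rightarrow> 'a \<Rightarrow> 'a set" where
  "parents n u v = {w \<in> sphere n u. (w, v) \<in> E}"

definition descendants :: "'a set \<Rightarrow> 'a set" where
  "descendants X = E\<^sup>* `` X"

definition separated :: "'a set \<Rightarrow> 'a set \<Rightarrow> bool" where
  "separated X Y \<longleftrightarrow> descendants X \<inter> descendants Y = {}"

lemma mem_sphere_iff: "v \<in> sphere n u \<longleftrightarrow> (u, v) \<in> E ^^ n"
  by (simp add: sphere_def)

lemma sphere_0 [simp]: "sphere 0 u = {u}"
  by (auto simp: sphere_def)

lemma sphere_add: "sphere (k + n) u = (\<Union>w\<in>sphere k u. sphere n w)"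
  by (auto simp: sphere_def relpow_add)

lemma sphere_Suc: "sphere (Suc n) u = E `` sphere n u"
  by (auto simp: sphere_def)

lemma sphere_Suc_children: "sphere (Suc n) u = (\<Union>x\<in>E `` {u}. sphere n x)"
  using sphere_add[of 1 n u] by (simp add: sphere_def)

lemma sphere_child_subset: "(u, x) \<in> E \<Longrightarrow> sphere n x \<subseteq> sphere (Suc n) u"
  by (auto simp: sphere_Suc_children)

lemma parents_child_subset:
  assumes "(u, x) \<in> E"
  shows "parents n x v \<subseteq> parents (Suc n) u v"
  using sphere_child_subset[OF assms] by (auto simp: parents_def)

lemma sphere_subset_verts: "u \<in> V \<Longrightarrow> sphere n u \<subseteq> V"
  by (cases n) (auto simp: sphere_Suc dest: in_arcsD2)

lemma descendants_eq_UN_sphere: "descendants X = (\<Union>x\<in>X. \<Union>n. sphere n x)"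
  by (force simp: descendants_def mem_sphere_iff rtrancl_power)

lemma descendants_Un: "descendants (X \<union> Y) = descendants X \<union> descendants Y"
  by (auto simp: descendants_def)

lemma subset_descendants: "X \<subseteq> descendants X"
  by (auto simp: descendants_def)

lemma sphere_subset_descendants: "sphere n u \<subseteq> descendants {u}"
  by (auto simp: descendants_eq_UN_sphere)

lemma descendants_subset: "Y \<subseteq> descendants X \<Longrightarrow> descendants Y \<subseteq> descendants X"
  unfolding descendants_def by (blast intro: rtrancl_trans)

lemma descendants_subset_verts: "X \<subseteq> V \<Longrightarrow> descendants X \<subseteq> V"
  using sphere_subset_verts by (auto simp: descendants_eq_UN_sphere)

lemma arc_closed_descendants: "v \<in> descendants X \<Longrightarrow> (v, w) \<in> E \<Longrightarrow> w \<in> descendants X"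
  by (auto simp: descendants_def intro: rtrancl_into_rtrancl)

lemma separated_sym: "separated X Y \<Longrightarrow> separated Y X"
  by (auto simp: separated_def)

lemma separated_mono:
  "separated X Y \<Longrightarrow> X' \<subseteq> descendants X \<Longrightarrow> Y' \<subseteq> descendants Y \<Longrightarrow> separated X' Y'"
  using descendants_subset unfolding separated_def by blast

lemma separated_rightI: "(\<And>y. y \<in> Y \<Longrightarrow> separated X {y}) \<Longrightarrow> separated X Y"
  by (fastforce simp: separated_def descendants_eq_UN_sphere)

lemma separated_UnI: "separated X Y \<Longrightarrow> separated X Z \<Longrightarrow> separated X (Y \<union> Z)"
  by (auto simp: separated_def descendants_Un)

lemma aut_arc_iff: "aut g \<Longrightarrow> u \<in> V \<Longrightarrow> v \<in> V \<Longrightarrow> (g u, g v) \<in> E \<longleftrightarrow> (u, v) \<in> E"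
  by (simp add: is_isomorphism_def)

lemma aut_arc: "aut g \<Longrightarrow> (u, v) \<in> E \<Longrightarrow> (g u, g v) \<in> E"
  using aut_arc_iff in_arcsD1 in_arcsD2 by blast

lemma aut_inj_on: "aut g \<Longrightarrow> X \<subseteq> V \<Longrightarrow> inj_on g X"
  by (auto simp: is_isomorphism_def bij_betw_def intro: inj_on_subset)

lemma aut_in_verts: "aut g \<Longrightarrow> u \<in> V \<Longrightarrow> g u \<in> V"
  by (auto simp: is_isomorphism_def bij_betw_def)

lemma aut_surjE:
  assumes "aut g" "v \<in> V"
  obtains u where "u \<in> V" "v = g u"
proof -
  have "g ` V = V" using assms(1) by (simp add: is_isomorphism_def bij_betw_def)
  with assms(2) that show thesis by (metis imageE)
qed

lemma aut_id: "aut id"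
  by (simp add: is_isomorphism_def)

lemma aut_Image_arcs:
  assumes g: "aut g" and X: "X \<subseteq> V"
  shows "E `` (g ` X) = g ` (E `` X)"
proof
  show "g ` (E `` X) \<subseteq> E `` (g ` X)"
    using aut_arc[OF g] by blast
  show "E `` (g ` X) \<subseteq> g ` (E `` X)"
  proof
    fix w assume "w \<in> E `` (g ` X)"
    then obtain x where x: "x \<in> X" "(g x, w) \<in> E" by blast
    obtain w' where "w' \<in> V" "w = g w'"
      using g in_arcsD2[OF x(2)] by (rule aut_surjE)
    then show "w \<in> g ` (E `` X)"
      using x X aut_arc_iff[OF g, of x w'] by blast
  qed
qed

lemma aut_sphere:
  assumes "aut g" "u \<in> V"
  shows "sphere n (g u) = g ` sphere n u"
  by (induction n)
    (simp_all add: sphere_Suc aut_Image_arcs[OF assms(1)] sphere_subset_verts[OF assms(2)])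

lemma aut_descendants: "aut g \<Longrightarrow> X \<subseteq> V \<Longrightarrow> descendants (g ` X) = g ` descendants X"
  by (auto simp: descendants_eq_UN_sphere subset_iff aut_sphere)

lemma aut_separated_iff:
  assumes "aut g" "X \<subseteq> V" "Y \<subseteq> V"
  shows "separated (g ` X) (g ` Y) \<longleftrightarrow> separated X Y"
proof -
  have "descendants (g ` X) \<inter> descendants (g ` Y) = g ` (descendants X \<inter> descendants Y)"
    using assms aut_inj_on[of g V]
    by (simp add: aut_descendants inj_on_image_Int[of g V] descendants_subset_verts)
  then show ?thesis by (simp add: separated_def)
qed

lemma vertex_transitiveE:
  assumes "vertex_transitive G" "u \<in> V" "v \<in> V"
  obtains g where "aut g" "g u = v"
  using assms unfolding vertex_transitive_def by blast

lemma card_sphere_eq: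
  assumes "vertex_transitive G" "u \<in> V" "v \<in> V"
  shows "card (sphere n u) = card (sphere n v)"
proof -
  obtain g where g: "aut g" "g u = v" using assms by (rule vertex_transitiveE)
  then have "sphere n v = g ` sphere n u" using aut_sphere assms(2) by blast
  then show ?thesis
    using aut_inj_on[OF g(1) sphere_subset_verts[OF assms(2)]] by (simp add: card_image)
qed

lemma ex_parent:
  assumes "vertex_transitive G" "(u, w) \<in> E" "v \<in> V"
  shows "\<exists>z. (z, v) \<in> E"
  using vertex_transitiveE[OF assms(1) in_arcsD2[OF assms(2)] assms(3)] aut_arc[OF _ assms(2)]
  by metis

lemma connected_arc_induct [consumes 3, case_names base fwd bwd]:
  assumes conn: "Digraph_Component.connected (with_proj G)" and "u \<in> V" "v \<in> V"
    and "P u"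
    and "\<And>x y. (x, y) \<in> E \<Longrightarrow> P x \<Longrightarrow> P y"
    and "\<And>x y. (x, y) \<in> E \<Longrightarrow> P y \<Longrightarrow> P x"
  shows "P v"
proof -
  have "reachable (with_proj (mk_symmetric (with_proj G))) u v"
    using conn assms(2,3) by (auto simp: connected_def strongly_connected_def)
  moreover have "parcs (mk_symmetric (with_proj G)) = E \<union> E\<inverse>"
    by (auto simp: parcs_mk_symmetric)
  ultimately have "(u, v) \<in> (E \<union> E\<inverse>)\<^sup>*"
    using reachable_rtranclI by fastforce
  then show ?thesis
    by (induction rule: rtrancl_induct) (use assms(4-6) in blast)+
qed

end

locale sinkless_digraph = pair_wf_digraph +
  assumes ex_child: "v \<in> V \<Longrightarrow> \<exists>w. (v, w) \<in> E"
begin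

lemma sphere_nonempty:
  assumes "u \<in> V"
  shows "sphere n u \<noteq> {}"
proof (induction n)
  case (Suc n)
  then obtain w where "w \<in> sphere n u" "w \<in> V" using sphere_subset_verts[OF assms] by blast
  with ex_child show ?case by (auto simp: sphere_Suc)
qed simp

text \<open>A common descendant of \<open>X\<close> and \<open>y\<close> has descendants at every further depth, and
  some of those lie below \<open>sphere n y\<close>.\<close>

lemma separated_if_separated_sphere:
  assumes y: "y \<in> V" and sep: "separated X (sphere n y)"
  shows "separated X {y}"
proof (rule ccontr)
  assume "\<not> separated X {y}"
  then obtain v k where v: "v \<in> descendants X" "v \<in> sphere k y"
    by (auto simp: separated_def descendants_eq_UN_sphere)
  then obtain t where t: "t \<in> sphere n v"
    using sphere_nonempty sphere_subset_verts[OF y] by blast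
  then have "t \<in> sphere (n + k) y"
    using v(2) sphere_add[of k n y] by (auto simp: add.commute)
  then have "t \<in> descendants (sphere n y)"
    by (auto simp: sphere_add descendants_eq_UN_sphere)
  moreover have "t \<in> descendants X"
    using t v(1) sphere_subset_descendants[of n v] descendants_subset[of "{v}" X] by blast
  ultimately show False
    using sep by (auto simp: separated_def)
qed

definition overlap_through_sphere :: "nat \<Rightarrow> 'a \<Rightarrow> 'a \<Rightarrow> bool" where
  "overlap_through_sphere n x y \<longleftrightarrow> separated {x} (sphere n y - sphere n x)"

lemma separated_if_disjoint_spheres:
  assumes "y \<in> V" "overlap_through_sphere n x y" "sphere n x \<inter> sphere n y = {}"
  shows "separated {x} {y}"
proof (rule separated_if_separated_sphere[OF assms(1)])
  have "sphere n y - sphere n x = sphere n y" using assms(3) by blast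
  then show "separated {x} (sphere n y)" using assms(2) by (simp add: overlap_through_sphere_def)
qed

lemma property_Z_if_arc_increment:
  fixes f :: "'a \<Rightarrow> int"
  assumes f: "\<And>u v. (u, v) \<in> E \<Longrightarrow> f v = f u + 1" and a: "a \<in> V"
    and inc: "\<And>v. v \<in> V \<Longrightarrow> \<exists>u. (u, v) \<in> E"
  shows "property_Z G"
proof -
  have "z \<in> f ` V" for z
  proof (induction z rule: int_induct[of _ "f a"])
    case base show ?case using a by blast
  next
    case (step1 z)
    then obtain v w where "f v = z" "(v, w) \<in> E" using ex_child by blast
    then show ?case using f in_arcsD2 by (metis imageI)
  next
    case (step2 z)
    then obtain u v where "f v = z" "(u, v) \<in> E" using inc by blast
    then show ?case using f[of u v] in_arcsD1 by (metis add_diff_cancel_right' imageI)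
  qed
  then have "f ` V = UNIV" by blast
  then show ?thesis unfolding property_Z_def using f by blast
qed

end

locale oriented_graph = pair_wf_digraph D for D :: "'a pair_pre_digraph" +
  assumes asym_arcs: "(u, v) \<in> parcs D \<Longrightarrow> (v, u) \<notin> parcs D"
begin

lemma is_s_arc_iff:
  assumes "u \<in> V"
  shows "is_s_arc D s p u v \<longleftrightarrow> p 0 = u \<and> p s = v \<and> (\<forall>i<s. (p i, p (Suc i)) \<in> E)"
proof
  assume p: "p 0 = u \<and> p s = v \<and> (\<forall>i<s. (p i, p (Suc i)) \<in> E)"
  have "p i \<in> V" if "i \<le> s" for i
    using p that assms in_arcsD2 by (cases i) (auto simp: Suc_le_eq)
  moreover have "p (i - 1) \<noteq> p (i + 1)" if "0 < i" "i < s" for i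
    using p that asym_arcs[of "p (i - 1)" "p i"] by (cases i) (auto dest: Suc_lessD)
  ultimately show "is_s_arc D s p u v" using p by (simp add: is_s_arc_def)
qed (simp add: is_s_arc_def)

lemma arc_sphere_eq_sphere: "u \<in> V \<Longrightarrow> arc_sphere D s u = sphere s u"
  by (auto simp: arc_sphere_def is_s_arc_iff mem_sphere_iff relpow_fun_conv)

lemma desc_set_eq_descendants: "X \<subseteq> V \<Longrightarrow> desc_set D X = descendants X"
  by (auto simp: desc_set_def desc_def arc_sphere_eq_sphere descendants_eq_UN_sphere subset_iff)

end

section \<open>The reachability relation\<close>

definition alternating_arc :: "(nat \<Rightarrow> 'a) \<Rightarrow> nat \<Rightarrow> 'a \<times> 'a" where
  "alternating_arc x i = (if even i then (x i, x (Suc i)) else (x (Suc i), x i))"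

lemma all_less_iff_even_odd:
  "(\<forall>j<n. P j) \<longleftrightarrow>
    (\<forall>i. (1 \<le> 2 * i \<and> 2 * i \<le> n \<longrightarrow> P (2 * i - 1)) \<and> (2 * i + 1 \<le> n \<longrightarrow> P (2 * i)))"
  for n :: nat
proof
  assume pairs: "\<forall>i. (1 \<le> 2 * i \<and> 2 * i \<le> n \<longrightarrow> P (2 * i - 1)) \<and> (2 * i + 1 \<le> n \<longrightarrow> P (2 * i))"
  show "\<forall>j<n. P j"
  proof (intro allI impI)
    fix j assume "j < n"
    then show "P j"
      using pairs[rule_format, of "j div 2"] pairs[rule_format, of "Suc (j div 2)"]
      by (cases "even j") (auto elim!: oddE)
  qed
qed auto

lemma alternating_walk_iff:
  "alternating_walk D n x \<longleftrightarrow> (\<forall>i\<le>n. x i \<in> pverts D) \<and>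
    ((\<forall>i<n. prod.swap (alternating_arc x i) \<in> parcs D) \<or> (\<forall>i<n. alternating_arc x i \<in> parcs D))"
proof -
  have odd: "alternating_arc x (2 * i - 1) = (x (2 * i), x (2 * i - 1))" if "1 \<le> 2 * i" for i
    using that by (cases i) (auto simp: alternating_arc_def)
  have even: "alternating_arc x (2 * i) = (x (2 * i), x (2 * i + 1))" for i
    by (simp add: alternating_arc_def)
  show ?thesis
    unfolding alternating_walk_def all_less_iff_even_odd using odd even by simp
qed

lemma equiv_quotient_singleton_iff:
  assumes "equiv A r"
  shows "(\<exists>C. A // r = {C}) \<longleftrightarrow> A \<noteq> {} \<and> r = A \<times> A"
proof
  assume "\<exists>C. A // r = {C}"
  then obtain C where C: "A // r = {C}" by blast
  then have "A = C" using Union_quotient[OF assms] by simp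
  moreover have "r `` {x} = C" if "x \<in> A" for x using quotientI[OF that, of r] C by simp
  moreover have "r \<subseteq> A \<times> A" using assms by (rule equivE)
  ultimately show "A \<noteq> {} \<and> r = A \<times> A" using C by auto
next
  assume "A \<noteq> {} \<and> r = A \<times> A"
  then show "\<exists>C. A // r = {C}" by (auto simp: quotient_def)
qed

context oriented_graph
begin

abbreviation reaches :: "'a \<times> 'a \<Rightarrow> 'a \<times> 'a \<Rightarrow> bool" (infix \<open>\<approx>\<close> 50) where
  "e \<approx> e' \<equiv> (e, e') \<in> reachability D"

definition alternating_path :: "'a \<times> 'a \<Rightarrow> nat \<Rightarrow> (nat \<Rightarrow> 'a) \<Rightarrow> 'a \<times> 'a \<Rightarrow> bool" where
  "alternating_path e n x e' \<longleftrightarrow>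
    (\<forall>i\<le>n. alternating_arc x i \<in> E) \<and> e = alternating_arc x 0 \<and> e' = alternating_arc x n"

lemma reaches_iff_alternating_path: "e \<approx> e' \<longleftrightarrow> (\<exists>n x. alternating_path e n x e')"
proof
  assume "e \<approx> e'"
  then obtain n x where e: "e \<in> E" "e' \<in> E" and n: "n \<ge> 1" and w: "alternating_walk D n x"
    and ends: "e = (x 0, x 1)" "e' = (x (n - 1), x n) \<or> e' = (x n, x (n - 1))"
    unfolding reachability_def by blast
  have "e = alternating_arc x 0" using ends by (simp add: alternating_arc_def)
  moreover have "prod.swap (alternating_arc x 0) \<notin> E"
    using asym_arcs e(1) ends(1) by (simp add: alternating_arc_def)
  with w n have arcs: "\<forall>i<n. alternating_arc x i \<in> E"
    unfolding alternating_walk_iff by (meson less_le_trans zero_less_one)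
  moreover obtain k where k: "n = Suc k" using n by (cases n) auto
  moreover have "e' = alternating_arc x k"
    using arcs[rule_format, of k] asym_arcs e(2) ends(2) k
    by (auto simp: alternating_arc_def split: if_splits)
  ultimately have "alternating_path e k x e'"
    by (simp add: alternating_path_def less_Suc_eq_le)
  then show "\<exists>n x. alternating_path e n x e'" by blast
next
  assume "\<exists>n x. alternating_path e n x e'"
  then obtain n x where arcs: "\<And>i. i \<le> n \<Longrightarrow> alternating_arc x i \<in> E"
    and ends: "e = alternating_arc x 0" "e' = alternating_arc x n"
    unfolding alternating_path_def by blast
  have "x i \<in> V" if "i \<le> Suc n" for i
    using arcs[of "i - 1"] arcs[of 0] that in_arcsD1 in_arcsD2
    by (cases i) (auto simp: alternating_arc_def split: if_splits)
  then have "alternating_walk D (Suc n) x" using arcs by (simp add: alternating_walk_iff)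
  then show "e \<approx> e'"
    using arcs[of 0] arcs[of n] ends unfolding reachability_def
    by (auto simp: alternating_arc_def intro!: exI[of _ "Suc n"] exI[of _ x])
qed

definition alternating_step :: "(('a \<times> 'a) \<times> ('a \<times> 'a)) set" where
  "alternating_step = {(e, e'). e \<in> E \<and> e' \<in> E \<and> (fst e = fst e' \<or> snd e = snd e')}"

text \<open>Two arcs are appended for each step, one of which repeats an arc of the step, so that the last
  index remains even.\<close>

lemma alternating_path_if_steps:
  assumes "(e, e') \<in> alternating_step\<^sup>*" "e \<in> E"
  shows "\<exists>n x. even n \<and> alternating_path e n x e'"
  using assms
proof (induction rule: rtrancl_induct)
  case base
  then show ?case
    by (intro exI[of _ 0] exI[of _ "\<lambda>i. if i = 0 then fst e else snd e"])
      (auto simp: alternating_path_def alternating_arc_def)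
next
  case (step e1 e2)
  then obtain n x where n: "even n" and x: "\<And>i. i \<le> n \<Longrightarrow> alternating_arc x i \<in> E"
    "e = alternating_arc x 0" "e1 = alternating_arc x n"
    unfolding alternating_path_def by blast
  have e1: "e1 = (x n, x (Suc n))" using n x(3) by (simp add: alternating_arc_def)
  define y where
    "y i = (if i \<le> Suc n then x i else if i = Suc (Suc n) then fst e2 else snd e2)" for i
  have y_arc: "alternating_arc y i = alternating_arc x i" if "i \<le> n" for i
    using that by (simp add: alternating_arc_def y_def)
  have "e2 \<in> E" "(fst e2, x (Suc n)) \<in> E"
    using step.hyps(2) e1 by (cases e2; auto simp: alternating_step_def)+
  then have "alternating_arc y (Suc n) \<in> E" "alternating_arc y (Suc (Suc n)) = e2"
    using n by (auto simp: alternating_arc_def y_def)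
  then show ?case
    using n x y_arc \<open>e2 \<in> E\<close>
    by (intro exI[of _ "Suc (Suc n)"] exI[of _ y]) (auto simp: alternating_path_def le_Suc_eq)
qed

lemma reachability_eq_trancl: "reachability D = alternating_step\<^sup>+"
proof (intro equalityI subrelI)
  fix e e' assume "e \<approx> e'"
  then obtain n x where x: "\<And>i. i \<le> n \<Longrightarrow> alternating_arc x i \<in> E"
    and ends: "e = alternating_arc x 0" "e' = alternating_arc x n"
    unfolding reaches_iff_alternating_path alternating_path_def by blast
  have "(e, alternating_arc x i) \<in> alternating_step\<^sup>+" if "i \<le> n" for i
    using that
  proof (induction i)
    case 0
    then show ?case using x[of 0] ends(1) by (auto simp: alternating_step_def)
  next
    case (Suc i)
    then have "(alternating_arc x i, alternating_arc x (Suc i)) \<in> alternating_step"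
      using x[of i] x[of "Suc i"] by (auto simp: alternating_step_def alternating_arc_def)
    with Suc show ?case by (meson Suc_leD trancl_into_trancl)
  qed
  then show "(e, e') \<in> alternating_step\<^sup>+" using ends(2) by blast
next
  fix e e' assume "(e, e') \<in> alternating_step\<^sup>+"
  moreover from this have "e \<in> E"
    by (induction rule: trancl_induct) (auto simp: alternating_step_def)
  ultimately show "e \<approx> e'"
    using alternating_path_if_steps[OF trancl_into_rtrancl]
    unfolding reaches_iff_alternating_path by metis
qed

lemma equiv_reachability: "equiv E (reachability D)"
proof (rule equivI)
  show "reachability D \<subseteq> E \<times> E" by (auto simp: reachability_def)
  show "refl_on E (reachability D)"
    unfolding reachability_eq_trancl by (auto simp: refl_on_def alternating_step_def)
  have "sym alternating_step" by (auto simp: sym_def alternating_step_def)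
  then show "sym (reachability D)" unfolding reachability_eq_trancl by (rule sym_trancl)
  show "trans (reachability D)" unfolding reachability_eq_trancl by (rule trans_trancl)
qed

lemma reaches_refl: "e \<in> E \<Longrightarrow> e \<approx> e"
  using equiv_reachability by (blast elim: equivE dest: refl_onD)

lemma reaches_sym: "e \<approx> e' \<Longrightarrow> e' \<approx> e"
  using equiv_reachability by (blast elim: equivE dest: symD)

lemma reaches_trans [trans]: "e \<approx> e' \<Longrightarrow> e' \<approx> e'' \<Longrightarrow> e \<approx> e''"
  using equiv_reachability by (blast elim: equivE dest: transD)

lemma reaches_in_arcs: "e \<approx> e' \<Longrightarrow> e \<in> E \<and> e' \<in> E"
  by (simp add: reachability_def)

lemma reaches_if_same_tail: "(a, b) \<in> E \<Longrightarrow> (a, c) \<in> E \<Longrightarrow> (a, b) \<approx> (a, c)"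
  by (auto simp: reachability_eq_trancl alternating_step_def)

lemma reaches_if_same_head: "(a, c) \<in> E \<Longrightarrow> (b, c) \<in> E \<Longrightarrow> (a, c) \<approx> (b, c)"
  by (auto simp: reachability_eq_trancl alternating_step_def)

lemma aut_reaches:
  assumes g: "aut g" and "(a, b) \<approx> (c, d)"
  shows "(g a, g b) \<approx> (g c, g d)"
proof -
  have step: "(map_prod g g e, map_prod g g e') \<in> alternating_step"
    if "(e, e') \<in> alternating_step" for e e'
    using that aut_arc[OF g] by (cases e; cases e') (auto simp: alternating_step_def)
  have "(map_prod g g e, map_prod g g e') \<in> alternating_step\<^sup>+"
    if "(e, e') \<in> alternating_step\<^sup>+" for e e'
    using that by (induction rule: trancl_induct) (auto intro: step trancl_into_trancl)
  from this[of "(a, b)" "(c, d)"] show ?thesis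
    using assms(2) by (simp add: reachability_eq_trancl)
qed

lemma reachability_universal_iff:
  "reachability_universal D \<longleftrightarrow> E \<noteq> {} \<and> (\<forall>e\<in>E. \<forall>e'\<in>E. e \<approx> e')"
  unfolding reachability_universal_def equiv_quotient_singleton_iff[OF equiv_reachability]
  using reaches_in_arcs by auto

lemma tail_level_eq_if_reaches:
  fixes f :: "'a \<Rightarrow> int"
  assumes f: "\<And>u v. (u, v) \<in> E \<Longrightarrow> f v = f u + 1" and "e \<approx> e'"
  shows "f (fst e) = f (fst e')"
  using assms(2) unfolding reachability_eq_trancl
proof (induction rule: trancl_induct)
  case (base e')
  then show ?case
    using f[of "fst e" "snd e"] f[of "fst e'" "snd e'"] by (auto simp: alternating_step_def)
next
  case (step e' e'')
  then show ?case
    using f[of "fst e'" "snd e'"] f[of "fst e''" "snd e''"] by (auto simp: alternating_step_def)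
qed

lemma not_reachability_universal_if_property_Z:
  assumes "property_Z D" "(a, b) \<in> E" "(b, c) \<in> E"
  shows "\<not> reachability_universal D"
proof
  assume "reachability_universal D"
  then have "(a, b) \<approx> (b, c)" using assms(2,3) by (simp add: reachability_universal_iff)
  moreover obtain f :: "'a \<Rightarrow> int" where f: "\<And>u v. (u, v) \<in> E \<Longrightarrow> f v = f u + 1"
    using assms(1) unfolding property_Z_def by blast
  ultimately have "f a = f b" using tail_level_eq_if_reaches[OF f] by fastforce
  then show False using f[OF assms(2)] by simp
qed

lemma consecutive_arcs_reach_if_vertex_transitive:
  assumes "vertex_transitive D" "(b, y) \<approx> (y, c)" "(p, q) \<in> E" "(q, r) \<in> E"
  shows "(p, q) \<approx> (q, r)"
proof -
  have arcs: "(b, y) \<in> E" "(y, c) \<in> E" using assms(2) reaches_in_arcs by auto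
  obtain g where g: "aut g" "g y = q"
    using assms(1) in_arcsD2[OF arcs(1)] in_arcsD2[OF assms(3)] by (rule vertex_transitiveE)
  have "(p, q) \<approx> (g b, q)"
    using reaches_if_same_head[OF assms(3)] aut_arc[OF g(1) arcs(1)] g(2) by simp
  also have "(g b, q) \<approx> (q, g c)"
    using aut_reaches[OF g(1) assms(2)] g(2) by simp
  also have "(q, g c) \<approx> (q, r)"
    using reaches_if_same_tail[OF _ assms(4)] aut_arc[OF g(1) arcs(2)] g(2) by simp
  finally show ?thesis .
qed

lemma reachability_universal_if_consecutive_arcs_reach:
  assumes conn: "Digraph_Component.connected (with_proj D)" and ne: "E \<noteq> {}"
    and consec: "\<And>p q r. (p, q) \<in> E \<Longrightarrow> (q, r) \<in> E \<Longrightarrow> (p, q) \<approx> (q, r)"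
  shows "reachability_universal D"
proof -
  have incident: "e \<approx> e'"
    if "e \<in> E" "e' \<in> E" "q \<in> {fst e, snd e}" "q \<in> {fst e', snd e'}" for e e' q
    using that consec reaches_sym[OF consec] reaches_if_same_tail reaches_if_same_head
    by (cases e; cases e') auto
  have "e \<approx> e'" if e: "e \<in> E" and e': "e' \<in> E" for e e'
  proof -
    have "fst e \<in> V" "fst e' \<in> V" using e e' arc_fst_in_verts by auto
    with conn have "\<forall>e''\<in>E. fst e' \<in> {fst e'', snd e''} \<longrightarrow> e \<approx> e''"
    proof (induction rule: connected_arc_induct)
      case base
      then show ?case using incident[OF e] by blast
    next
      case (fwd x y)
      then show ?case using incident[OF fwd.hyps, of _ y] reaches_trans[of e "(x, y)"] by auto
    next
      case (bwd x y)
      then show ?case using incident[OF bwd.hyps, of _ x] reaches_trans[of e "(x, y)"] by auto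
    qed
    then show ?thesis using e' by blast
  qed
  with ne show ?thesis by (simp add: reachability_universal_iff)
qed

end

section \<open>Gluing automorphisms\<close>

lemma is_isomorphism_glue:
  assumes g: "is_isomorphism (induced_subdigraph D A) (induced_subdigraph D' A') g"
    and h: "is_isomorphism (induced_subdigraph D B) (induced_subdigraph D' B') h"
    and disj: "A \<inter> B = {}" "A' \<inter> B' = {}"
    and closed: "parcs D `` A \<subseteq> A" "parcs D `` B \<subseteq> B" "parcs D' `` A' \<subseteq> A'" "parcs D' `` B' \<subseteq> B'"
  shows "is_isomorphism (induced_subdigraph D (A \<union> B)) (induced_subdigraph D' (A' \<union> B'))
    (\<lambda>v. if v \<in> A then g v else h v)" (is "is_isomorphism _ _ ?f")
proof -
  have f_A: "?f v = g v" if "v \<in> A" for v using that by simp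
  have f_B: "?f v = h v" if "v \<in> B" for v using that disj(1) by auto
  have gh: "bij_betw g A A'" "bij_betw h B B'"
    using g h by (simp_all add: is_isomorphism_def induced_subdigraph_def)
  then have image: "v \<in> A \<Longrightarrow> g v \<in> A'" "v \<in> B \<Longrightarrow> h v \<in> B'" for v
    by (auto dest: bij_betwE)
  have "bij_betw ?f A A'" "bij_betw ?f B B'"
    using gh bij_betw_cong[of A ?f g A'] bij_betw_cong[of B ?f h B'] f_A f_B by blast+
  then have bij: "bij_betw ?f (A \<union> B) (A' \<union> B')"
    using disj(2) by (rule bij_betw_combine)
  have "(u, v) \<in> parcs D \<longleftrightarrow> (?f u, ?f v) \<in> parcs D'"
    if uv: "u \<in> A \<union> B" "v \<in> A \<union> B" for u v
  proof -
    consider (within_A) "u \<in> A" "v \<in> A" | (within_B) "u \<in> B" "v \<in> B"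
      | (A_to_B) "u \<in> A" "v \<in> B" | (B_to_A) "u \<in> B" "v \<in> A"
      using uv by blast
    then show ?thesis
    proof cases
      case within_A
      with g image f_A show ?thesis by (auto simp: is_isomorphism_def induced_subdigraph_def)
    next
      case within_B
      with h image f_B show ?thesis by (auto simp: is_isomorphism_def induced_subdigraph_def)
    next
      case A_to_B
      then have "(u, v) \<notin> parcs D" "(g u, h v) \<notin> parcs D'"
        using closed(1,3) disj image by blast+
      with A_to_B f_A f_B show ?thesis by simp
    next
      case B_to_A
      then have "(u, v) \<notin> parcs D" "(h u, g v) \<notin> parcs D'"
        using closed(2,4) disj image by blast+
      with B_to_A f_A f_B show ?thesis by simp
    qed
  qed
  then show ?thesis
    using bij bij_betwE[OF bij] by (simp add: is_isomorphism_def induced_subdigraph_def)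
qed

lemma is_isomorphism_restrict:
  assumes "is_automorphism D g" "X \<subseteq> pverts D"
  shows "is_isomorphism (induced_subdigraph D X) (induced_subdigraph D (g ` X)) g"
  using assms
  by (auto simp: is_isomorphism_def induced_subdigraph_def bij_betw_def subset_iff
      intro: inj_on_subset)

context oriented_graph
begin

lemma weakly_descendant_homogeneousE:
  assumes "weakly_descendant_homogeneous D" "finite X" "X \<subseteq> V" "finite Y" "Y \<subseteq> V"
    "is_isomorphism (induced_subdigraph D (descendants X)) (induced_subdigraph D (descendants Y)) f"
  obtains k where "aut k" "\<And>x. x \<in> X \<Longrightarrow> k x = f x"
proof -
  have "is_isomorphism (induced_subdigraph D (desc_set D X))
      (induced_subdigraph D (desc_set D Y)) f"
    using assms by (simp add: desc_set_eq_descendants)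
  with assms(1-5) have "\<exists>k. aut k \<and> (\<forall>x\<in>X. k x = f x)"
    unfolding weakly_descendant_homogeneous_def by simp
  with that show thesis by blast
qed

lemma glue_automorphisms:
  assumes wdh: "weakly_descendant_homogeneous D"
    and X: "finite X" "X \<subseteq> V" and Y: "finite Y" "Y \<subseteq> V"
    and g: "aut g" and h: "aut h"
    and sep: "separated X Y" "separated (g ` X) (h ` Y)"
  obtains k where "aut k" "\<And>x. x \<in> X \<Longrightarrow> k x = g x" "\<And>y. y \<in> Y \<Longrightarrow> k y = h y"
proof -
  let ?A = "descendants X" and ?B = "descendants Y"
  let ?f = "\<lambda>v. if v \<in> ?A then g v else h v"
  have AB: "?A \<subseteq> V" "?B \<subseteq> V" using X(2) Y(2) by (simp_all add: descendants_subset_verts)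
  have desc_image: "g ` ?A = descendants (g ` X)" "h ` ?B = descendants (h ` Y)"
    using X(2) Y(2) g h by (simp_all add: aut_descendants)
  have "is_isomorphism (induced_subdigraph D (?A \<union> ?B)) (induced_subdigraph D (g ` ?A \<union> h ` ?B)) ?f"
  proof (rule is_isomorphism_glue)
    show "?A \<inter> ?B = {}" "g ` ?A \<inter> h ` ?B = {}"
      using sep by (simp_all add: separated_def desc_image)
    show "is_isomorphism (induced_subdigraph D ?A) (induced_subdigraph D (g ` ?A)) g"
      "is_isomorphism (induced_subdigraph D ?B) (induced_subdigraph D (h ` ?B)) h"
      using g h AB by (simp_all add: is_isomorphism_restrict)
  qed (use arc_closed_descendants in \<open>auto simp: desc_image\<close>)
  then have iso: "is_isomorphism (induced_subdigraph D (descendants (X \<union> Y)))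
      (induced_subdigraph D (descendants (g ` X \<union> h ` Y))) ?f"
    by (simp add: descendants_Un desc_image)
  have "finite (X \<union> Y)" "X \<union> Y \<subseteq> V" "finite (g ` X \<union> h ` Y)" "g ` X \<union> h ` Y \<subseteq> V"
    using X Y aut_in_verts g h by auto
  from weakly_descendant_homogeneousE[OF wdh this iso]
  obtain k where k: "aut k" "\<And>v. v \<in> X \<union> Y \<Longrightarrow> k v = ?f v"
    by blast
  have "k x = g x" if "x \<in> X" for x
    using that k(2) subset_descendants[of X] by auto
  moreover have "k y = h y" if "y \<in> Y" for y
    using that k(2) sep(1) subset_descendants[of Y] by (auto simp: separated_def)
  ultimately show thesis using that k(1) by blast
qed

text \<open>An automorphism fixing \<open>x\<close> and moving \<open>y\<close> to an out-neighbour \<open>c\<close> takes the arc into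
  \<open>x\<close> to another arc into \<open>x\<close>, but the arc into \<open>y\<close> to one with the same head as \<open>(y, c)\<close>.\<close>

lemma consecutive_arcs_reach_if_separated_heads:
  assumes wdh: "weakly_descendant_homogeneous D"
    and reach: "(a, x) \<approx> (b, y)" and child: "(y, c) \<in> E" and sep: "separated {x} {y}"
  shows "(b, y) \<approx> (y, c)"
proof -
  have arcs: "(a, x) \<in> E" "(b, y) \<in> E" using reach reaches_in_arcs by auto
  have V: "{x} \<subseteq> V" "{y} \<subseteq> V" "y \<in> V" "c \<in> V" using arcs child in_arcsD2 in_arcsD1 by auto
  obtain h where h: "aut h" "h y = c"
    using wdh V(3,4) unfolding weakly_descendant_homogeneous_def by (blast elim: vertex_transitiveE)
  have "{c} \<subseteq> descendants {y}"
    using arc_closed_descendants[OF _ child] subset_descendants by blast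
  then have "separated (id ` {x}) (h ` {y})"
    using separated_mono[OF sep subset_descendants] h(2) by simp
  then obtain k where k: "aut k" "k x = x" "k y = c"
    using glue_automorphisms[OF wdh _ V(1) _ V(2) aut_id h(1) sep] h(2) by auto
  have "(b, y) \<approx> (a, x)" using reach by (rule reaches_sym)
  also have "(a, x) \<approx> (k a, x)"
    using reaches_if_same_head[OF arcs(1)] aut_arc[OF k(1) arcs(1)] k(2) by simp
  also have "(k a, x) \<approx> (k b, c)"
    using aut_reaches[OF k(1) reach] k by simp
  also have "(k b, c) \<approx> (y, c)"
    using reaches_if_same_head[OF _ child] aut_arc[OF k(1) arcs(2)] k(3) by simp
  finally show ?thesis .
qed

end

section \<open>Acyclic distance-transitive digraphs\<close>

lemma acyclic_if_no_directed_cycle: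
  assumes "\<not> has_directed_cycle D"
  shows "acyclic (parcs D)"
proof (rule acyclicI, intro allI notI)
  fix x assume "(x, x) \<in> (parcs D)\<^sup>+"
  then obtain n p where "n > 0" "p 0 = x" "p n = x" "\<forall>i<n. (p i, p (Suc i)) \<in> parcs D"
    by (auto simp: trancl_power relpow_fun_conv)
  then have "has_directed_cycle D"
    unfolding has_directed_cycle_def by (intro exI[of _ n] exI[of _ p]) auto
  with assms show False by simp
qed

lemma acyclic_finite_minimal:
  assumes "acyclic r" "finite A" "A \<noteq> {}"
  obtains z where "z \<in> A" "\<And>w. w \<in> A \<Longrightarrow> (w, z) \<notin> r\<^sup>+"
proof -
  have irrefl: "(w, w) \<notin> r\<^sup>+" for w using assms(1) by (simp add: acyclic_def)
  have "\<exists>z\<in>A. \<forall>w\<in>A. w \<noteq> z \<longrightarrow> (w, z) \<notin> r\<^sup>+"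
  proof (rule Finite_Set.bex_min_element[OF assms(2) _ _ assms(3)])
    show "asymp_on A (\<lambda>w z. (w, z) \<in> r\<^sup>+)"
      by (rule asymp_onI) (use irrefl trancl_trans in metis)
    show "transp_on A (\<lambda>w z. (w, z) \<in> r\<^sup>+)"
      by (rule transp_onI) (rule trancl_trans)
  qed
  with irrefl that show thesis by metis
qed

locale acyclic_digraph = pair_wf_digraph D for D :: "'a pair_pre_digraph" +
  assumes acyclic_arcs: "acyclic (parcs D)"

sublocale acyclic_digraph \<subseteq> oriented_graph
  using acyclic_arcs by unfold_locales (meson acyclic_def r_into_trancl trancl_into_trancl)

locale out_regular_digraph = pair_wf_digraph D for D :: "'a pair_pre_digraph" and m :: nat +
  assumes out_degree: "\<forall>v\<in>V. finite (out_arcs (with_proj D) v) \<and> out_degree (with_proj D) v = m"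
    and out_degree_pos: "m > 0"
begin

lemma out_arcs_eq: "out_arcs (with_proj D) v = Pair v ` (E `` {v})"
  by (auto simp: out_arcs_def)

lemma finite_children: "v \<in> V \<Longrightarrow> finite (E `` {v})"
  using out_degree by (auto simp: out_arcs_eq dest: finite_imageD intro: inj_onI)

lemma card_children: "v \<in> V \<Longrightarrow> card (E `` {v}) = m"
  using out_degree by (simp add: out_arcs_eq out_degree_def card_image inj_on_def)

sublocale sinkless_digraph D
proof
  show "\<exists>w. (v, w) \<in> E" if "v \<in> V" for v
    using card_children[OF that] out_degree_pos by (cases "E `` {v} = {}") auto
qed

lemma finite_sphere:
  assumes "u \<in> V"
  shows "finite (sphere n u)"
proof (induction n)
  case (Suc n)
  have "sphere (Suc n) u = (\<Union>w\<in>sphere n u. E `` {w})" by (auto simp: sphere_Suc)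
  with Suc show ?case using finite_children sphere_subset_verts[OF assms] by (auto simp: subset_iff)
qed simp

lemma finite_parents: "u \<in> V \<Longrightarrow> finite (parents n u v)"
  by (simp add: parents_def finite_sphere)

lemma card_sphere_pos: "u \<in> V \<Longrightarrow> card (sphere n u) > 0"
  using finite_sphere sphere_nonempty by (simp add: card_gt_0_iff)

end

locale distance_transitive_dag = acyclic_digraph D + out_regular_digraph D m
  for D :: "'a pair_pre_digraph" and m :: nat +
  assumes connected: "Digraph_Component.connected (with_proj D)"
    and distance_transitive: "distance_transitive D"
begin

lemma distance_transitiveE:
  assumes "u \<in> V" "u' \<in> V" "v \<in> sphere s u" "v' \<in> sphere s u'"
    "\<And>t. t < s \<Longrightarrow> v \<notin> sphere t u" "\<And>t. t < s \<Longrightarrow> v' \<notin> sphere t u'"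
  obtains g where "aut g" "g u = u'" "g v = v'"
proof -
  have "at_distance D s u v" "at_distance D s u' v'"
    using assms by (simp_all add: at_distance_def arc_sphere_eq_sphere)
  with that show thesis using distance_transitive unfolding distance_transitive_def by blast
qed

lemma vertex_transitive: "vertex_transitive D"
  unfolding vertex_transitive_def
proof (intro ballI)
  fix u v assume "u \<in> V" "v \<in> V"
  then obtain g where "aut g" "g u = v"
    by (rule distance_transitiveE[where s = 0 and v = u and v' = v]) auto
  then show "\<exists>g. aut g \<and> g u = v" by blast
qed

text \<open>At a minimal counterexample \<open>s\<close>, distance transitivity puts another member of
  \<open>sphere s u\<close> strictly above each member, impossible in a finite acyclic set.\<close>

lemma disjoint_spheres_less:
  assumes "u \<in> V" "s < t"
  shows "sphere s u \<inter> sphere t u = {}"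
  using assms
proof (induction s arbitrary: u t rule: less_induct)
  case (less s)
  show ?case
  proof (rule ccontr)
    assume "sphere s u \<inter> sphere t u \<noteq> {}"
    then obtain v where v: "v \<in> sphere s u" "v \<in> sphere t u" by blast
    have minimal: "v' \<notin> sphere r u" if "v' \<in> sphere s u" "r < s" for v' r
      using less.IH[OF that(2) less.prems(1) that(2)] that(1) by blast
    have "\<exists>w\<in>sphere s u. (w, v') \<in> E\<^sup>+" if v': "v' \<in> sphere s u" for v'
    proof -
      obtain g where g: "aut g" "g u = u" "g v = v'"
        using less.prems(1) less.prems(1) v(1) v' minimal[OF v(1)] minimal[OF v']
        by (rule distance_transitiveE)
      then have "v' \<in> sphere (s + (t - s)) u"
        using aut_sphere[OF g(1) less.prems(1), of t] v(2) less.prems(2) by auto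
      then obtain w where "w \<in> sphere s u" "v' \<in> sphere (t - s) w"
        unfolding sphere_add by blast
      with less.prems(2) show ?thesis
        by (auto simp: mem_sphere_iff trancl_power intro!: bexI[of _ w] exI[of _ "t - s"])
    qed
    moreover obtain z where "z \<in> sphere s u" "\<And>w. w \<in> sphere s u \<Longrightarrow> (w, z) \<notin> E\<^sup>+"
      using acyclic_finite_minimal[OF acyclic_arcs finite_sphere[OF less.prems(1)]] v(1) by blast
    ultimately show False by blast
  qed
qed

lemma sphere_depth_unique:
  assumes "u \<in> V" "v \<in> sphere s u" "v \<in> sphere t u"
  shows "s = t"
  using disjoint_spheres_less[OF assms(1), of s t] disjoint_spheres_less[OF assms(1), of t s]
    assms(2,3)
  by (cases s t rule: linorder_cases) auto

lemma sphere_transitiveE: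
  assumes "u \<in> V" "u' \<in> V" "v \<in> sphere n u" "v' \<in> sphere n u'"
  obtains g where "aut g" "g u = u'" "g v = v'"
  using assms
proof (rule distance_transitiveE)
  show "v \<notin> sphere t u" if "t < n" for t
    using sphere_depth_unique[OF assms(1,3), of t] that by blast
  show "v' \<notin> sphere t u'" if "t < n" for t
    using sphere_depth_unique[OF assms(2,4), of t] that by blast
qed

definition indeg :: "nat \<Rightarrow> nat" where
  "indeg n = (THE d. \<forall>u\<in>V. \<forall>v\<in>sphere (Suc n) u. card (parents n u v) = d)"

lemma card_parents_eq:
  assumes u: "u \<in> V" "v \<in> sphere (Suc n) u" and u': "u' \<in> V" "v' \<in> sphere (Suc n) u'"
  shows "card (parents n u v) = card (parents n u' v')"
proof -
  obtain g where g: "aut g" "g u = u'" "g v = v'"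
    using u(1) u'(1) u(2) u'(2) by (rule sphere_transitiveE)
  have V: "v \<in> V" "sphere n u \<subseteq> V" using u sphere_subset_verts by blast+
  have "sphere n u' = g ` sphere n u" using aut_sphere[OF g(1) u(1)] g(2) by simp
  then have "parents n u' v' = g ` parents n u v"
    using aut_arc_iff[OF g(1) _ V(1)] V(2) g(3) by (auto simp: parents_def)
  moreover have "inj_on g (parents n u v)"
    using V(2) by (intro aut_inj_on[OF g(1)]) (auto simp: parents_def)
  ultimately show ?thesis by (simp add: card_image)
qed

lemma card_parents:
  assumes "u \<in> V" "v \<in> sphere (Suc n) u"
  shows "card (parents n u v) = indeg n"
  unfolding indeg_def
  by (rule the_equality[symmetric]) (use assms card_parents_eq[OF assms] in auto)

text \<open>Both sides count the arcs from \<open>sphere n u\<close> to \<open>sphere (Suc n) u\<close>.\<close>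

lemma card_sphere_mult_out_degree:
  assumes u: "u \<in> V"
  shows "card (sphere n u) * m = indeg n * card (sphere (Suc n) u)"
proof -
  have "{v \<in> sphere (Suc n) u. (w, v) \<in> E} = E `` {w}" if "w \<in> sphere n u" for w
    using that by (auto simp: sphere_Suc)
  then have "card (sphere n u) * m = (\<Sum>w\<in>sphere n u. card {v \<in> sphere (Suc n) u. (w, v) \<in> E})"
    using card_children sphere_subset_verts[OF u] by (simp add: subset_iff)
  also have "\<dots> = indeg n * card (sphere (Suc n) u)"
    using card_parents[OF u] finite_sphere[OF u] by (intro sum_multicount) (auto simp: parents_def)
  finally show ?thesis .
qed

lemma card_sphere_less_Suc_iff:
  assumes u: "u \<in> V"
  shows "card (sphere n u) < card (sphere (Suc n) u) \<longleftrightarrow> indeg n < m"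
proof -
  let ?c = "card (sphere n u)" and ?c' = "card (sphere (Suc n) u)"
  have "?c < ?c' \<longleftrightarrow> ?c * m < m * ?c'"
    using out_degree_pos by (simp add: mult.commute[of m])
  also have "\<dots> \<longleftrightarrow> indeg n * ?c' < m * ?c'"
    unfolding card_sphere_mult_out_degree[OF u, of n] ..
  also have "\<dots> \<longleftrightarrow> indeg n < m"
    using card_sphere_pos[OF u, of "Suc n"] by simp
  finally show ?thesis .
qed

lemma P3_iff_indeg_less:
  assumes "\<alpha> \<in> V"
  shows "P3 (descendant_subdigraph D \<alpha>) \<alpha> \<longleftrightarrow> (\<forall>n\<ge>1. indeg n < m)"
  using assms
  by (simp add: P3_def arc_sphere_descendant_subdigraph arc_sphere_eq_sphere
      flip: card_sphere_less_Suc_iff[OF assms])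

lemma indeg_le_Suc:
  assumes "(u, x) \<in> E"
  shows "indeg n \<le> indeg (Suc n)"
proof -
  have u: "u \<in> V" and x: "x \<in> V" using assms wellformed' by auto
  obtain v where v: "v \<in> sphere (Suc n) x" using sphere_nonempty[OF x] by blast
  then have "v \<in> sphere (Suc (Suc n)) u" using sphere_child_subset[OF assms] by blast
  then show ?thesis
    using card_parents[OF x v] card_parents[OF u, of v "Suc n"]
      card_mono[OF finite_parents[OF u] parents_child_subset[OF assms, of n v]] by simp
qed

lemma indeg_mono:
  assumes "u \<in> V" "i \<le> j"
  shows "indeg i \<le> indeg j"
  using assms(2) indeg_le_Suc ex_child[OF assms(1)] by (metis lift_Suc_mono_le)

lemma parents_child_eq:
  assumes arc: "(u, x) \<in> E" and v: "v \<in> sphere (Suc n) x" and stable: "indeg (Suc n) = indeg n"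
  shows "parents (Suc n) u v = parents n x v"
proof -
  have u: "u \<in> V" and x: "x \<in> V" using arc wellformed' by auto
  have "v \<in> sphere (Suc (Suc n)) u" using v sphere_child_subset[OF arc] by blast
  then have "card (parents n x v) = card (parents (Suc n) u v)"
    using card_parents[OF x v] card_parents[OF u] stable by simp
  then show ?thesis
    using card_subset_eq[OF finite_parents[OF u] parents_child_subset[OF arc, of n v]] by simp
qed

end

section \<open>Level functions from stationary spheres\<close>

lemma eventually_constant_if_antimono_nat:
  fixes f :: "nat \<Rightarrow> nat"
  assumes "\<And>k. k \<ge> i \<Longrightarrow> f (Suc k) \<le> f k"
  obtains K where "K \<ge> i" "\<And>k. k \<ge> K \<Longrightarrow> f k = f K"
proof -
  obtain K where K: "K \<ge> i" "\<And>k. k \<ge> i \<Longrightarrow> f K \<le> f k"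
    using ex_has_least_nat[of "\<lambda>k. k \<ge> i" i f] by blast
  have "f k \<le> f K" if "k \<ge> K" for k
    using that
  proof (induction k rule: dec_induct)
    case (step k)
    then show ?case using assms[of k] K(1) by simp
  qed simp
  with K that show thesis by (meson le_antisym le_trans)
qed

context distance_transitive_dag
begin

lemma sphere_Suc_eventually_eq_sphere_child:
  assumes a: "a \<in> V" and i: "m \<le> indeg i"
  obtains K where "\<And>u x k. (u, x) \<in> E \<Longrightarrow> k \<ge> K \<Longrightarrow> sphere (Suc k) u = sphere k x"
proof -
  have "card (sphere (Suc k) a) \<le> card (sphere k a)" if "k \<ge> i" for k
    using card_sphere_less_Suc_iff[OF a, of k] indeg_mono[OF a that] i by simp
  then obtain K where K: "\<And>k. k \<ge> K \<Longrightarrow> card (sphere k a) = card (sphere K a)"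
    using eventually_constant_if_antimono_nat[of i "\<lambda>k. card (sphere k a)"] by blast
  show thesis
  proof
    fix u x k assume arc: "(u, x) \<in> E" and k: "k \<ge> K"
    then have V: "u \<in> V" "x \<in> V" using wellformed' by auto
    have "card (sphere k x) = card (sphere (Suc k) u)"
      using K[of k] K[of "Suc k"] k card_sphere_eq[OF vertex_transitive _ a] V by simp
    then show "sphere (Suc k) u = sphere k x"
      using card_subset_eq[OF finite_sphere[OF V(1)] sphere_child_subset[OF arc, of k]] by simp
  qed
qed

text \<open>Integer depths make the shift by one along an arc invertible; \<open>nat\<close> is harmless because
  only large depths matter.\<close>

definition relative_level :: "'a \<Rightarrow> 'a \<Rightarrow> int \<Rightarrow> bool" where
  "relative_level a v z \<longleftrightarrow> (\<exists>L. \<forall>k\<ge>L. sphere (nat (k + z)) a = sphere (nat k) v)"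

lemma relative_level_arc_iff:
  assumes "\<And>k. k \<ge> K \<Longrightarrow> sphere (Suc k) v = sphere k w"
  shows "relative_level a w (z + 1) \<longleftrightarrow> relative_level a v z"
proof -
  have shift: "sphere (nat (k + 1)) v = sphere (nat k) w" if "k \<ge> int K" for k
    using assms[of "nat k"] that by (simp add: nat_add_distrib)
  show ?thesis
  proof
    assume "relative_level a w (z + 1)"
    then obtain L where tail: "\<And>k. k \<ge> L \<Longrightarrow> sphere (nat (k + (z + 1))) a = sphere (nat k) w"
      unfolding relative_level_def by blast
    have "sphere (nat (k + z)) a = sphere (nat k) v" if "k \<ge> max L (int K) + 1" for k
      using tail[of "k - 1"] shift[of "k - 1"] that by (simp add: algebra_simps)
    then show "relative_level a v z" unfolding relative_level_def by blast
  next
    assume "relative_level a v z"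
    then obtain L where tail: "\<And>k. k \<ge> L \<Longrightarrow> sphere (nat (k + z)) a = sphere (nat k) v"
      unfolding relative_level_def by blast
    have "sphere (nat (k + (z + 1))) a = sphere (nat k) w" if "k \<ge> max L (int K)" for k
      using tail[of "k + 1"] shift[of k] that by (simp add: algebra_simps)
    then show "relative_level a w (z + 1)" unfolding relative_level_def by blast
  qed
qed

lemma relative_level_unique:
  assumes a: "a \<in> V" and "relative_level a v z" "relative_level a v z'"
  shows "z = z'"
proof -
  obtain L L' where tail: "\<And>k. k \<ge> L \<Longrightarrow> sphere (nat (k + z)) a = sphere (nat k) v"
    and tail': "\<And>k. k \<ge> L' \<Longrightarrow> sphere (nat (k + z')) a = sphere (nat k) v"
    using assms(2,3) unfolding relative_level_def by blast
  define k where "k = max L L' + \<bar>L\<bar> + \<bar>z\<bar> + \<bar>z'\<bar>"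
  have k: "k \<ge> L" "k \<ge> L'" "k + z \<ge> 0" "k + z' \<ge> 0" by (auto simp: k_def)
  then have "sphere (nat (k + z)) a = sphere (nat (k + z')) a" using tail tail' by simp
  moreover obtain t where "t \<in> sphere (nat (k + z)) a"
    using sphere_nonempty[OF a] by blast
  ultimately have "nat (k + z) = nat (k + z')" using sphere_depth_unique[OF a] by blast
  then show ?thesis using k by simp
qed

lemma property_Z_if_indeg_ge:
  assumes a: "a \<in> V" and "m \<le> indeg i"
  shows "property_Z D"
proof -
  obtain K where "\<And>u x k. (u, x) \<in> E \<Longrightarrow> k \<ge> K \<Longrightarrow> sphere (Suc k) u = sphere k x"
    using sphere_Suc_eventually_eq_sphere_child[OF assms] by metis
  then have level_iff: "relative_level a w (z + 1) \<longleftrightarrow> relative_level a v z" if "(v, w) \<in> E" for v w z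
    using that by (intro relative_level_arc_iff[of K])
  have "\<exists>z. relative_level a v z" if "v \<in> V" for v
    using connected a that
  proof (induction rule: connected_arc_induct)
    case base
    have "relative_level a a 0" by (simp add: relative_level_def)
    then show ?case by blast
  next
    case (fwd x y)
    then show ?case using level_iff by blast
  next
    case (bwd x y)
    then obtain z where "relative_level a y ((z - 1) + 1)" by auto
    then show ?case using level_iff[OF bwd.hyps] by blast
  qed
  then obtain f where f: "\<And>v. v \<in> V \<Longrightarrow> relative_level a v (f v)" by metis
  obtain b where b: "(a, b) \<in> E" using ex_child[OF a] by blast
  show ?thesis
  proof (rule property_Z_if_arc_increment)
    show "f w = f v + 1" if arc: "(v, w) \<in> E" for v w
    proof (rule relative_level_unique[OF a])
      show "relative_level a w (f w)" using f in_arcsD2[OF arc] by blast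
      show "relative_level a w (f v + 1)" using f[OF in_arcsD1[OF arc]] level_iff[OF arc] by blast
    qed
  qed (use a ex_parent[OF vertex_transitive b] in auto)
qed

end

section \<open>Descendants under a stable in-degree\<close>

locale stable_indegree_dag = distance_transitive_dag D m for D :: "'a pair_pre_digraph" and m +
  fixes N :: nat
  assumes homogeneous: "weakly_descendant_homogeneous D"
    and indeg_stable: "\<And>n. n \<ge> N \<Longrightarrow> indeg n = indeg N"
    and indeg_less: "indeg N < m"
begin

text \<open>A stable in-degree leaves a vertex below \<open>x\<close> no parent that is below \<open>u\<close> but not below \<open>x\<close>.\<close>

lemma mem_sphere_child_if_descendant:
  assumes arc: "(u, x) \<in> E" and w: "w \<in> sphere (Suc N) u"
    and v: "v \<in> sphere n w" "v \<in> sphere (N + n) x"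
  shows "w \<in> sphere N x"
  using v
proof (induction n arbitrary: v)
  case (Suc n)
  then obtain v' where v': "v' \<in> sphere n w" "(v', v) \<in> E" by (auto simp: sphere_Suc)
  have "v' \<in> sphere (Suc N + n) u" using w v'(1) unfolding sphere_add by blast
  then have "v' \<in> parents (Suc (N + n)) u v" using v'(2) by (simp add: parents_def)
  moreover have "parents (Suc (N + n)) u v = parents (N + n) x v"
    using arc Suc.prems(2) indeg_stable[of "N + n"] indeg_stable[of "Suc (N + n)"]
    by (intro parents_child_eq) simp_all
  ultimately have "v' \<in> parents (N + n) x v" by simp
  then have "v' \<in> sphere (N + n) x" by (simp add: parents_def)
  with v'(1) show ?case by (rule Suc.IH)
qed simp

lemma separated_child_if_outside:
  assumes arc: "(u, x) \<in> E" and w: "w \<in> sphere (Suc N) u" "w \<notin> sphere N x"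
  shows "separated {x} {w}"
proof (rule ccontr)
  assume "\<not> separated {x} {w}"
  then obtain v k n where v: "v \<in> sphere k x" "v \<in> sphere n w"
    by (auto simp: separated_def descendants_eq_UN_sphere)
  have "v \<in> sphere (Suc k) u" "v \<in> sphere (Suc N + n) u"
    using v w(1) sphere_child_subset[OF arc] unfolding sphere_add by blast+
  then have "k = N + n" using sphere_depth_unique[OF in_arcsD1[OF arc]] by fastforce
  with v w mem_sphere_child_if_descendant[OF arc] show False by blast
qed

lemma ex_outside_child:
  assumes arc: "(u, x) \<in> E"
  obtains w where "w \<in> sphere (Suc N) u" "w \<notin> sphere N x"
proof -
  have V: "u \<in> V" "x \<in> V" using arc wellformed' by auto
  have "card (sphere N x) < card (sphere (Suc N) u)"
    using card_sphere_less_Suc_iff[OF V(1)] indeg_less card_sphere_eq[OF vertex_transitive V]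
    by simp
  then have "\<not> sphere (Suc N) u \<subseteq> sphere N x"
    using card_mono[OF finite_sphere[OF V(2)]] by (meson not_less)
  with that show thesis by blast
qed

lemma ex_separated_descendants:
  assumes u: "u \<in> V"
  obtains x w where "x \<in> descendants {u}" "w \<in> descendants {u}" "separated {x} {w}"
proof -
  obtain x where x: "(u, x) \<in> E" using ex_child[OF u] by blast
  obtain w where w: "w \<in> sphere (Suc N) u" "w \<notin> sphere N x" using x by (rule ex_outside_child)
  have "x \<in> descendants {u}" using x by (auto simp: descendants_def)
  moreover have "w \<in> descendants {u}" using w(1) sphere_subset_descendants by blast
  ultimately show thesis using separated_child_if_outside[OF x w] that by blast
qed

lemma ex_separated_vertex:
  assumes x: "x \<in> V"
  obtains s where "s \<in> V" "separated {x} {s}"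
proof -
  obtain p q where pq: "p \<in> descendants {x}" "q \<in> descendants {x}" "separated {p} {q}"
    using x by (rule ex_separated_descendants)
  then have V: "p \<in> V" "q \<in> V" using descendants_subset_verts[of "{x}"] x by auto
  obtain g where g: "aut g" "g p = x" using vertex_transitive V(1) x by (rule vertex_transitiveE)
  have "separated {x} {g q}"
    using aut_separated_iff[OF g(1), of "{p}" "{q}"] V pq(3) g(2) by simp
  then show thesis using that aut_in_verts[OF g(1) V(2)] by blast
qed

lemma ex_separated_triple:
  assumes x: "x \<in> V"
  obtains s t where "s \<in> V" "t \<in> V" "separated {x} {s}" "separated {x} {t}" "separated {s} {t}"
proof -
  obtain r where r: "r \<in> V" "separated {x} {r}" using x by (rule ex_separated_vertex)
  obtain s t where st: "s \<in> descendants {r}" "t \<in> descendants {r}" "separated {s} {t}"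
    using r(1) by (rule ex_separated_descendants)
  then have "s \<in> V" "t \<in> V" using descendants_subset_verts[of "{r}"] r(1) by auto
  moreover have "separated {x} {s}" "separated {x} {t}"
    using separated_mono[OF r(2) subset_descendants] st(1,2) by simp_all
  ultimately show thesis using that st(3) by blast
qed

lemma overlap_through_sphere_siblings:
  assumes "(u, x) \<in> E" "(u, y) \<in> E"
  shows "overlap_through_sphere N x y"
  unfolding overlap_through_sphere_def
proof (rule separated_rightI)
  show "separated {x} {w}" if "w \<in> sphere N y - sphere N x" for w
    using that sphere_child_subset[OF assms(2)] separated_child_if_outside[OF assms(1)] by blast
qed

text \<open>Homogeneity moves the part of \<open>sphere N y\<close> outside \<open>sphere N x\<close> away from a vertex \<open>t\<close>
  separated from \<open>x\<close>; the preimage of \<open>t\<close> is then separated from both.\<close>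

lemma ex_separated_from_both:
  assumes x: "x \<in> V" and y: "y \<in> V" and overlap: "overlap_through_sphere N x y"
  obtains t where "t \<in> V" "separated {t} {x}" "separated {t} {y}"
proof -
  obtain s t where st: "s \<in> V" "t \<in> V"
    and sep: "separated {x} {s}" "separated {x} {t}" "separated {s} {t}"
    using x by (rule ex_separated_triple)
  let ?W = "sphere N y - sphere N x"
  have W: "finite ?W" "?W \<subseteq> V" using finite_sphere[OF y] sphere_subset_verts[OF y] by auto
  obtain h where h: "aut h" "h y = s" using vertex_transitive y st(1) by (rule vertex_transitiveE)
  have hW: "h ` ?W \<subseteq> descendants {s}"
    using aut_sphere[OF h(1) y, of N] h(2) sphere_subset_descendants[of N s] by blast
  have single: "finite {x}" "{x} \<subseteq> V" using x by simp_all
  have "separated {x} ?W" using overlap unfolding overlap_through_sphere_def .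
  moreover have "separated (id ` {x}) (h ` ?W)"
    using separated_mono[OF sep(1) subset_descendants hW] unfolding image_id by simp
  ultimately obtain k where "aut k" "\<And>v. v \<in> {x} \<Longrightarrow> k v = id v" "\<And>w. w \<in> ?W \<Longrightarrow> k w = h w"
    by (rule glue_automorphisms[OF homogeneous single W aut_id h(1)]) blast
  then have k: "aut k" "k x = x" "\<And>w. w \<in> ?W \<Longrightarrow> k w = h w" by simp_all
  obtain t' where t': "t' \<in> V" "t = k t'" using k(1) st(2) by (rule aut_surjE)
  have pull: "separated {t'} X" if "X \<subseteq> V" "separated {t} (k ` X)" for X
    using aut_separated_iff[OF k(1), of "{t'}" X] t' that by simp
  have sep_x: "separated {t'} {x}"
    using x k(2) separated_sym[OF sep(2)] by (intro pull) simp_all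
  have "k ` ?W \<subseteq> descendants {s}" using hW k(3) by auto
  then have "separated {t'} ?W"
    using W(2) by (intro pull separated_mono[OF separated_sym[OF sep(3)] subset_descendants])
  with sep_x have "separated {t'} ({x} \<union> ?W)" by (rule separated_UnI)
  moreover have "sphere N y \<subseteq> descendants ({x} \<union> ?W)"
    unfolding descendants_Un using sphere_subset_descendants[of N x] subset_descendants[of ?W]
    by blast
  ultimately have "separated {t'} (sphere N y)" by (rule separated_mono[OF _ subset_descendants])
  then have "separated {t'} {y}" by (rule separated_if_separated_sphere[OF y])
  with t'(1) sep_x show thesis by (rule that)
qed

lemma ex_sibling_avoiding:
  assumes arc: "(b, y) \<in> E" and p: "p \<in> sphere N y"
  obtains u z where "(u, y) \<in> E" "(u, z) \<in> E" "p \<notin> sphere N z"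
proof -
  obtain w where w: "w \<in> sphere (Suc N) b" "w \<notin> sphere N y" using arc by (rule ex_outside_child)
  then obtain c where child: "(b, c) \<in> E" "w \<in> sphere N c" by (auto simp: sphere_Suc_children)
  have V: "y \<in> V" "c \<in> V" using arc child(1) in_arcsD2 by auto
  have "\<not> sphere N y \<subseteq> sphere N c"
    using card_subset_eq[OF finite_sphere[OF V(2)] _ card_sphere_eq[OF vertex_transitive V], of N]
      child(2) w(2) by blast
  then obtain q where q: "q \<in> sphere N y" "q \<notin> sphere N c" by blast
  obtain g where g: "aut g" "g y = y" "g q = p"
    using V(1) V(1) q(1) p by (rule sphere_transitiveE)
  have "(g b, y) \<in> E" "(g b, g c) \<in> E"
    using aut_arc[OF g(1) arc] aut_arc[OF g(1) child(1)] g(2) by simp_all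
  moreover have "p \<notin> sphere N (g c)"
    using q(2) aut_sphere[OF g(1) V(2), of N] g(3)
      inj_on_image_mem_iff[OF aut_inj_on[OF g(1) order_refl] _ sphere_subset_verts[OF V(2)], of q N]
      subsetD[OF sphere_subset_verts[OF V(1)] q(1)] by simp
  ultimately show thesis by (rule that)
qed

lemma ex_aut_moving_sibling:
  assumes yz: "(u, y) \<in> E" "(u, z) \<in> E" and t: "t \<in> V" "separated {t} {y}"
  obtains k where "aut k" "k y = y" "\<forall>v\<in>sphere N y. k v = v"
    "k ` (sphere N z - sphere N y) \<subseteq> descendants {t}"
proof -
  have V: "u \<in> V" "y \<in> V" "z \<in> V" using yz wellformed' by auto
  obtain h where h: "aut h" "h u = t" using vertex_transitive V(1) t(1) by (rule vertex_transitiveE)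
  let ?X = "insert y (sphere N y)" and ?Y = "sphere N z - sphere N y"
  have X: "finite ?X" "?X \<subseteq> V" and Y: "finite ?Y" "?Y \<subseteq> V"
    using V finite_sphere sphere_subset_verts[OF V(2)] sphere_subset_verts[OF V(3)]
    by (auto simp: subset_iff)
  have X_desc: "?X \<subseteq> descendants {y}"
    using sphere_subset_descendants subset_descendants by blast
  have hY: "h ` ?Y \<subseteq> descendants {t}"
    using aut_sphere[OF h(1) V(1), of "Suc N"] h(2) sphere_child_subset[OF yz(2)]
      sphere_subset_descendants[of "Suc N" t] by blast
  have "separated ?X ?Y"
    using overlap_through_sphere_siblings[OF yz] separated_mono[OF _ X_desc subset_descendants]
    by (simp add: overlap_through_sphere_def)
  moreover have "separated (id ` ?X) (h ` ?Y)"
    using separated_mono[OF separated_sym[OF t(2)] X_desc hY] by simp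
  ultimately obtain k where "aut k" "\<And>v. v \<in> ?X \<Longrightarrow> k v = id v" "\<And>v. v \<in> ?Y \<Longrightarrow> k v = h v"
    using glue_automorphisms[OF homogeneous X Y aut_id h(1)] by metis
  with hY show thesis by (intro that[of k]) auto
qed

text \<open>A sibling of \<open>y\<close>, moved by an automorphism fixing \<open>y\<close> and its sphere so that the part of its
  own sphere outside \<open>sphere N y\<close> avoids \<open>x\<close>, shares less with \<open>x\<close> than \<open>y\<close> does.\<close>

lemma ex_reachable_arc_smaller_overlap:
  assumes x: "x \<in> V" and arc: "(b, y) \<in> E" and overlap: "overlap_through_sphere N x y"
    and meet: "sphere N x \<inter> sphere N y \<noteq> {}"
  obtains b' z where "(b, y) \<approx> (b', z)" "overlap_through_sphere N x z"
    "sphere N x \<inter> sphere N z \<subset> sphere N x \<inter> sphere N y"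
proof -
  have y: "y \<in> V" using in_arcsD2[OF arc] .
  obtain p where p: "p \<in> sphere N x" "p \<in> sphere N y" using meet by blast
  obtain u z where uz: "(u, y) \<in> E" "(u, z) \<in> E" "p \<notin> sphere N z"
    using arc p(2) by (rule ex_sibling_avoiding)
  obtain t where t: "t \<in> V" "separated {t} {x}" "separated {t} {y}"
    using x y overlap by (rule ex_separated_from_both)
  obtain k where k: "aut k" "k y = y" "\<forall>v\<in>sphere N y. k v = v"
    "k ` (sphere N z - sphere N y) \<subseteq> descendants {t}"
    using uz(1,2) t(1,3) by (rule ex_aut_moving_sibling)
  have sphere_kz: "sphere N (k z) \<subseteq> (sphere N y \<inter> sphere N z) \<union> descendants {t}"
    using aut_sphere[OF k(1) in_arcsD2[OF uz(2)], of N] k(3,4) by fastforce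
  have "(b, y) \<approx> (k u, y)"
    using reaches_if_same_head[OF arc] aut_arc[OF k(1) uz(1)] k(2) by simp
  also have "(k u, y) \<approx> (k u, k z)"
    using reaches_if_same_tail aut_arc[OF k(1) uz(1)] aut_arc[OF k(1) uz(2)] k(2) by simp
  finally have reach: "(b, y) \<approx> (k u, k z)" .
  have "separated {x} ((sphere N y - sphere N x) \<union> {t})"
    using overlap separated_sym[OF t(2)] unfolding overlap_through_sphere_def
    by (rule separated_UnI)
  moreover have "sphere N (k z) - sphere N x \<subseteq> descendants ((sphere N y - sphere N x) \<union> {t})"
    unfolding descendants_Un using sphere_kz subset_descendants[of "sphere N y - sphere N x"]
    by blast
  ultimately have overlap': "overlap_through_sphere N x (k z)"
    unfolding overlap_through_sphere_def using separated_mono subset_descendants by blast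
  have "sphere N x \<inter> descendants {t} = {}"
    using t(2) sphere_subset_descendants[of N x] by (auto simp: separated_def)
  then have "sphere N x \<inter> sphere N (k z) \<subset> sphere N x \<inter> sphere N y"
    using sphere_kz p uz(3) by blast
  with reach overlap' show thesis by (rule that)
qed

lemma ex_reachable_arc_separated_head:
  assumes x: "x \<in> V" and "(b, y) \<in> E" "overlap_through_sphere N x y"
  shows "\<exists>b' z. (b, y) \<approx> (b', z) \<and> separated {x} {z}"
  using assms(2,3)
proof (induction "card (sphere N x \<inter> sphere N y)" arbitrary: b y rule: less_induct)
  case less
  show ?case
  proof (cases "sphere N x \<inter> sphere N y = {}")
    case True
    then show ?thesis
      using separated_if_disjoint_spheres[OF in_arcsD2] less.prems reaches_refl by blast
  next
    case False
    with x less.prems obtain b' z where z: "(b, y) \<approx> (b', z)" "overlap_through_sphere N x z"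
      "sphere N x \<inter> sphere N z \<subset> sphere N x \<inter> sphere N y"
      by (rule ex_reachable_arc_smaller_overlap)
    then have "card (sphere N x \<inter> sphere N z) < card (sphere N x \<inter> sphere N y)"
      using finite_sphere[OF x] by (intro psubset_card_mono) auto
    moreover have "(b', z) \<in> E" using z(1) reaches_in_arcs by simp
    ultimately obtain b'' w where "(b', z) \<approx> (b'', w)" "separated {x} {w}"
      using less.hyps z(2) by blast
    then show ?thesis using reaches_trans[OF z(1)] by blast
  qed
qed

lemma reachability_universal:
  assumes "E \<noteq> {}"
  shows "reachability_universal D"
proof -
  obtain a x where a: "(a, x) \<in> E" using assms by auto
  have "overlap_through_sphere N x x"
    by (simp add: overlap_through_sphere_def separated_def descendants_def)
  then obtain b y where y: "(a, x) \<approx> (b, y)" "separated {x} {y}"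
    using ex_reachable_arc_separated_head[OF in_arcsD2[OF a] a] by blast
  then obtain c where child: "(y, c) \<in> E" using reaches_in_arcs in_arcsD2 ex_child by blast
  have "(b, y) \<approx> (y, c)"
    using homogeneous y(1) child y(2) by (rule consecutive_arcs_reach_if_separated_heads)
  then have "(p, q) \<approx> (q, r)" if "(p, q) \<in> E" "(q, r) \<in> E" for p q r
    using that by (rule consecutive_arcs_reach_if_vertex_transitive[OF vertex_transitive])
  then show ?thesis
    by (rule reachability_universal_if_consecutive_arcs_reach[OF connected assms])
qed

end

lemma (in distance_transitive_dag) reachability_universal_if_indeg_less:
  assumes wdh: "weakly_descendant_homogeneous D" and a: "a \<in> V"
    and less: "\<And>n. n \<ge> i \<Longrightarrow> indeg n < m"
  shows "reachability_universal D"
proof -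
  obtain N where N: "N \<ge> i" "\<And>n. n \<ge> N \<Longrightarrow> m - indeg n = m - indeg N"
    using eventually_constant_if_antimono_nat[of i "\<lambda>n. m - indeg n"] indeg_mono[OF a]
    by (metis diff_le_mono2 le_SucI order_refl)
  interpret stable_indegree_dag D m N
  proof unfold_locales
    show "indeg n = indeg N" if "n \<ge> N" for n
      using N(2)[OF that] less[of n] less[of N] N(1) that by linarith
  qed (use wdh less N(1) in auto)
  show ?thesis using reachability_universal ex_child[OF a] by blast
qed

theorem theorem1p3:
  fixes D :: "'a pair_pre_digraph" and m :: nat and \<alpha> :: 'a
  assumes "pair_loopfree_digraph D"
    and "infinite (pverts D)"
    and "Digraph_Component.connected (with_proj D)"
    and "distance_transitive D"
    and "weakly_descendant_homogeneous D"
    and "m > 0"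
    and "\<forall>v\<in>pverts D. finite (out_arcs (with_proj D) v) \<and> out_degree (with_proj D) v = m"
    and "\<not> has_directed_cycle D"
    and "\<alpha> \<in> pverts D"
  shows "(property_Z D \<longleftrightarrow> \<not> reachability_universal D) \<and>
         (\<not> reachability_universal D \<longleftrightarrow> \<not> P3 (descendant_subdigraph D \<alpha>) \<alpha>)"
proof -
  interpret pair_loopfree_digraph D by (rule assms(1))
  interpret distance_transitive_dag D m
    using assms acyclic_if_no_directed_cycle by unfold_locales simp_all
  have P3_iff: "P3 (descendant_subdigraph D \<alpha>) \<alpha> \<longleftrightarrow> (\<forall>n\<ge>1. indeg n < m)"
    using assms(9) by (rule P3_iff_indeg_less)
  obtain \<beta> \<gamma> where "(\<alpha>, \<beta>) \<in> E" "(\<beta>, \<gamma>) \<in> E"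
    using ex_child assms(9) in_arcsD2 by metis
  then have "\<not> reachability_universal D" if "property_Z D"
    using that by (intro not_reachability_universal_if_property_Z)
  moreover have "property_Z D" if "\<not> P3 (descendant_subdigraph D \<alpha>) \<alpha>"
    using that property_Z_if_indeg_ge[OF assms(9)] by (auto simp: P3_iff not_less)
  moreover have "reachability_universal D" if "P3 (descendant_subdigraph D \<alpha>) \<alpha>"
    using that reachability_universal_if_indeg_less[OF assms(5,9)] by (auto simp: P3_iff)
  ultimately show ?thesis by blast
qed

end
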